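(* Let $G$ be an undirected graph and let $\overleftrightarrow{G}$ be its complete biorientation. Then $\mathrm{pw}(G)=\mathrm{d\text{-}pw}(\overleftrightarrow G)$, $\mathrm{cutw}(G)=\mathrm{d\text{-}cutw}(\overleftrightarrow G)$, $\mathrm{nw}(G)=\mathrm{d\text{-}nw}(\overleftrightarrow G)$, $\mathrm{lnlcw}(G)=\mathrm{d\text{-}lnlcw}(\overleftrightarrow G)$, $\mathrm{lcw}(G)=\mathrm{d\text{-}lcw}(\overleftrightarrow G)$, and $\mathrm{lrw}(G)=\mathrm{d\text{-}lrw}(\overleftrightarrow G)$.
   Context: The complete biorientation of an undirected graph $G=(V,E)$ is the digraph on $V$ with arcs $(u,v)$ and $(v,u)$ for every edge $\{u,v\}\in E$. Digraphs $G=(V,E)$ are finite with $E\subseteq\{(u,v):u\ne v\}$. A layout is a bijection $\varphi:V\to\{1,\dots,|V|\}$; $L(i,\varphi)=\{u:\varphi(u)\le i\}$, $R(i,\varphi)=\{u:\varphi(u)>i\}$. Directed parameters: $\mathrm{d\text{-}pw}(G)$ is the minimum of $\max|X_i|-1$ over sequences $(X_1,\dots,X_r)$ of subsets of $V$ with $\bigcup X_i=V$, for each $(u,v)\in E$ some $i\le j$ with $u\in X_i,v\in X_j$, and $X_i\cap X_\ell\subseteq X_j$ for $i<j<\ell$. $\mathrm{d\text{-}cutw}(G)=\min_\varphi\max_i|\{(u,v)\in E:u\in L(i,\varphi),v\in R(i,\varphi)\}|$. With $N_i(u)=(\{v\in R(i,\varphi):(u,v)\in E\},\{v\in R(i,\varphi):(v,u)\in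 E\})$, $\mathrm{d\text{-}nw}(G)=\min_\varphi\max_i|\{N_i(u):u\in L(i,\varphi)\}|$. $\mathrm{d\text{-}lnlcw}(G)$ is the least $k$ such that $G$ (under some labeling) is built from labeled digraphs with labels in $[k]$ by: $\bullet_a$; $H\otimes_{(\overrightarrow S,\overleftarrow S)}\bullet_a$ ($\overrightarrow S,\overleftarrow S\subseteq[k]^2$): add a new vertex $v$ labeled $a$ and arcs $(u,v)$ for each $u$ in $H$ of label $b$ with $(b,a)\in\overrightarrow S$, and arcs $(v,u)$ for each $u$ in $H$ of label $b$ with $(b,a)\in\overleftarrow S$; $\circ_R$ for $R:[k]\to[k]$ (relabel $a$ to $R(a)$). $\mathrm{d\text{-}lcw}(G)$ is the least number of labels to build $G$ with $\bullet_a$, $H\oplus\bullet_a$, $\alpha_{a,b}$ ($a\ne b$; arcs from all label-$a$ to all label-$b$ vertices), $\rho_{a\to b}$. $\mathrm{d\text{-}lrw}(G)$: minimum over pairs $(T,f)$, $T$ a caterpillar (a path with pendant vertices), $f$ a bijection from $V$ to the leaves of $T$, of the maximum over edges $e$ of $T$ (splitting $V$ into $A_e,B_e$) of the $GF(4)$-rank of the $A_e\times B_e$ matrix with entry $0$ (no arc between $x,y$), $\omega$ (only $(x,y)$), $\omega^2$ (only $(y,x)$), $1$ (both), where $GF(4)=\{0,1,\omega,\omega^2\}$. Undirected parameters: $\mathrm{pw}$ as $\mathrm{d\text{-}pw}$ but each edge lies in a single bag; $\mathrm{cutw}(G)=\min_\varphi\max_i$ number of edges between $L(i,\varphi)$ and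 $R(i,\varphi)$; $\mathrm{nw}(G)=\min_\varphi\max_i|\{N(u)\cap R(i,\varphi):u\in L(i,\varphi)\}|$; $\mathrm{lnlcw}$ as $\mathrm{d\text{-}lnlcw}$ with operation $H\times_S\bullet_a$ adding edges between the new vertex and all vertices of label $b$ with $(b,a)\in S$; $\mathrm{lcw}$ as $\mathrm{d\text{-}lcw}$ with $\eta_{a,b}$ adding all edges between labels $a$ and $b$; $\mathrm{lrw}$ as $\mathrm{d\text{-}lrw}$ with the $0/1$ adjacency matrix and rank over $GF(2)$. *)

theory Defs
  imports Complex_Main "HOL-Library.FuncSet" "HOL-Library.Z2" "HOL-Library.Function_Algebras"
begin

section \<open>Graphs and layouts\<close>

definition ugraph :: "'a set \<Rightarrow> 'a set set \<Rightarrow> bool" where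
  "ugraph V E \<longleftrightarrow> finite V \<and> E \<subseteq> {{u, v} | u v. u \<in> V \<and> v \<in> V \<and> u \<noteq> v}"

definition biorientation :: "'a set set \<Rightarrow> ('a \<times> 'a) set" where
  "biorientation E = {(u, v). {u, v} \<in> E}"

definition layouts :: "'a set \<Rightarrow> ('a \<Rightarrow> nat) set" where
  "layouts V = {\<phi>. bij_betw \<phi> V {1..card V}}"

definition L_set :: "'a set \<Rightarrow> nat \<Rightarrow> ('a \<Rightarrow> nat) \<Rightarrow> 'a set" where
  "L_set V i \<phi> = {u \<in> V. \<phi> u \<le> i}"

definition R_set :: "'a set \<Rightarrow> nat \<Rightarrow> ('a \<Rightarrow> nat) \<Rightarrow> 'a set" where
  "R_set V i \<phi> = {u \<in> V. \<phi> u > i}"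

section \<open>Path-width\<close>

definition bag_sequence :: "'a set \<Rightarrow> 'a set list \<Rightarrow> bool" where
  "bag_sequence V X \<longleftrightarrow> X \<noteq> [] \<and> \<Union>(set X) = V \<and>
     (\<forall>i j l. i < j \<and> j < l \<and> l < length X \<longrightarrow> X ! i \<inter> X ! l \<subseteq> X ! j)"

definition path_decompositions :: "'a set \<Rightarrow> 'a set set \<Rightarrow> 'a set list set" where
  "path_decompositions V E =
     {X. bag_sequence V X \<and> (\<forall>e\<in>E. \<exists>i<length X. e \<subseteq> X ! i)}"

definition d_path_decompositions :: "'a set \<Rightarrow> ('a \<times> 'a) set \<Rightarrow> 'a set list set" where
  "d_path_decompositions V E =
     {X. bag_sequence V X \<and>
         (\<forall>(u, v)\<in>E. \<exists>i j. i \<le> j \<and> j < length X \<and> u \<in> X ! i \<and> v \<in> X ! j)}"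

definition bag_width :: "'a set list \<Rightarrow> int" where
  "bag_width X = int (Max (card ` set X)) - 1"

definition pw :: "'a set \<Rightarrow> 'a set set \<Rightarrow> int" where
  "pw V E = (INF X\<in>path_decompositions V E. bag_width X)"

definition d_pw :: "'a set \<Rightarrow> ('a \<times> 'a) set \<Rightarrow> int" where
  "d_pw V E = (INF X\<in>d_path_decompositions V E. bag_width X)"

section \<open>Cut-width\<close>

definition cutw :: "'a set \<Rightarrow> 'a set set \<Rightarrow> nat" where
  "cutw V E = (INF \<phi>\<in>layouts V. SUP i\<in>{1..card V}.
     card {e \<in> E. \<exists>u\<in>L_set V i \<phi>. \<exists>v\<in>R_set V i \<phi>. e = {u, v}})"

definition d_cutw :: "'a set \<Rightarrow> ('a \<times> 'a) set \<Rightarrow> nat" where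
  "d_cutw V E = (INF \<phi>\<in>layouts V. SUP i\<in>{1..card V}.
     card {(u, v) \<in> E. u \<in> L_set V i \<phi> \<and> v \<in> R_set V i \<phi>})"

section \<open>Neighbourhood-width\<close>

definition nw :: "'a set \<Rightarrow> 'a set set \<Rightarrow> nat" where
  "nw V E = (INF \<phi>\<in>layouts V. SUP i\<in>{1..card V}.
     card ((\<lambda>u. {v. {u, v} \<in> E} \<inter> R_set V i \<phi>) ` L_set V i \<phi>))"

definition d_nw :: "'a set \<Rightarrow> ('a \<times> 'a) set \<Rightarrow> nat" where
  "d_nw V E = (INF \<phi>\<in>layouts V. SUP i\<in>{1..card V}.
     card ((\<lambda>u. ({v \<in> R_set V i \<phi>. (u, v) \<in> E}, {v \<in> R_set V i \<phi>. (v, u) \<in> E})) ` L_set V i \<phi>))"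

section \<open>Linear NLC-width\<close>

text \<open>A labeled graph is given by its vertex set, its edge set and a labeling function, whose
  values outside the vertex set are irrelevant.\<close>

inductive lnlc :: "nat \<Rightarrow> 'a set \<Rightarrow> 'a set set \<Rightarrow> ('a \<Rightarrow> nat) \<Rightarrow> bool" for k where
  lnlc_vertex: "a \<in> {1..k} \<Longrightarrow> lnlc k {v} {} (\<lambda>_. a)"
| lnlc_insert: "lnlc k V E lab \<Longrightarrow> v \<notin> V \<Longrightarrow> a \<in> {1..k} \<Longrightarrow> S \<subseteq> {1..k} \<times> {1..k} \<Longrightarrow>
    lnlc k (insert v V) (E \<union> {{u, v} | u. u \<in> V \<and> (lab u, a) \<in> S}) (lab(v := a))"
| lnlc_relabel: "lnlc k V E lab \<Longrightarrow> f \<in> {1..k} \<rightarrow> {1..k} \<Longrightarrow> lnlc k V E (f \<circ> lab)"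

inductive d_lnlc :: "nat \<Rightarrow> 'a set \<Rightarrow> ('a \<times> 'a) set \<Rightarrow> ('a \<Rightarrow> nat) \<Rightarrow> bool" for k where
  d_lnlc_vertex: "a \<in> {1..k} \<Longrightarrow> d_lnlc k {v} {} (\<lambda>_. a)"
| d_lnlc_insert: "d_lnlc k V E lab \<Longrightarrow> v \<notin> V \<Longrightarrow> a \<in> {1..k} \<Longrightarrow>
    S \<subseteq> {1..k} \<times> {1..k} \<Longrightarrow> S' \<subseteq> {1..k} \<times> {1..k} \<Longrightarrow>
    d_lnlc k (insert v V)
      (E \<union> {(u, v) | u. u \<in> V \<and> (lab u, a) \<in> S} \<union> {(v, u) | u. u \<in> V \<and> (lab u, a) \<in> S'})
      (lab(v := a))"
| d_lnlc_relabel: "d_lnlc k V E lab \<Longrightarrow> f \<in> {1..k} \<rightarrow> {1..k} \<Longrightarrow> d_lnlc k V E (f \<circ> lab)"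

definition lnlcw :: "'a set \<Rightarrow> 'a set set \<Rightarrow> nat" where
  "lnlcw V E = (LEAST k. \<exists>lab. lnlc k V E lab)"

definition d_lnlcw :: "'a set \<Rightarrow> ('a \<times> 'a) set \<Rightarrow> nat" where
  "d_lnlcw V E = (LEAST k. \<exists>lab. d_lnlc k V E lab)"

section \<open>Linear clique-width\<close>

inductive lc :: "nat \<Rightarrow> 'a set \<Rightarrow> 'a set set \<Rightarrow> ('a \<Rightarrow> nat) \<Rightarrow> bool" for k where
  lc_vertex: "a \<in> {1..k} \<Longrightarrow> lc k {v} {} (\<lambda>_. a)"
| lc_insert: "lc k V E lab \<Longrightarrow> v \<notin> V \<Longrightarrow> a \<in> {1..k} \<Longrightarrow> lc k (insert v V) E (lab(v := a))"
| lc_join: "lc k V E lab \<Longrightarrow> a \<in> {1..k} \<Longrightarrow> b \<in> {1..k} \<Longrightarrow> a \<noteq> b \<Longrightarrow>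
    lc k V (E \<union> {{u, v} | u v. u \<in> V \<and> v \<in> V \<and> lab u = a \<and> lab v = b}) lab"
| lc_relabel: "lc k V E lab \<Longrightarrow> a \<in> {1..k} \<Longrightarrow> b \<in> {1..k} \<Longrightarrow>
    lc k V E (\<lambda>v. if lab v = a then b else lab v)"

inductive d_lc :: "nat \<Rightarrow> 'a set \<Rightarrow> ('a \<times> 'a) set \<Rightarrow> ('a \<Rightarrow> nat) \<Rightarrow> bool" for k where
  d_lc_vertex: "a \<in> {1..k} \<Longrightarrow> d_lc k {v} {} (\<lambda>_. a)"
| d_lc_insert: "d_lc k V E lab \<Longrightarrow> v \<notin> V \<Longrightarrow> a \<in> {1..k} \<Longrightarrow> d_lc k (insert v V) E (lab(v := a))"
| d_lc_join: "d_lc k V E lab \<Longrightarrow> a \<in> {1..k} \<Longrightarrow> b \<in> {1..k} \<Longrightarrow> a \<noteq> b \<Longrightarrow>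
    d_lc k V (E \<union> {(u, v) | u v. u \<in> V \<and> v \<in> V \<and> lab u = a \<and> lab v = b}) lab"
| d_lc_relabel: "d_lc k V E lab \<Longrightarrow> a \<in> {1..k} \<Longrightarrow> b \<in> {1..k} \<Longrightarrow>
    d_lc k V E (\<lambda>v. if lab v = a then b else lab v)"

definition lcw :: "'a set \<Rightarrow> 'a set set \<Rightarrow> nat" where
  "lcw V E = (LEAST k. \<exists>lab. lc k V E lab)"

definition d_lcw :: "'a set \<Rightarrow> ('a \<times> 'a) set \<Rightarrow> nat" where
  "d_lcw V E = (LEAST k. \<exists>lab. d_lc k V E lab)"

section \<open>The field with four elements\<close>

text \<open>\<open>GF4 a b\<close> is the element \<open>a + b \<omega>\<close> of \<open>GF(2)[\<omega>]\<close> with \<open>\<omega>\<^sup>2 = \<omega> + 1\<close>;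
  the inverse of a nonzero element is its square.\<close>

datatype gf4 = GF4 bit bit

instantiation gf4 :: field
begin

definition zero_gf4 :: gf4 where "0 = GF4 0 0"
definition one_gf4 :: gf4 where "1 = GF4 1 0"

fun plus_gf4 :: "gf4 \<Rightarrow> gf4 \<Rightarrow> gf4" where
  "GF4 a b + GF4 c d = GF4 (a + c) (b + d)"

definition uminus_gf4 :: "gf4 \<Rightarrow> gf4" where "- x = (x :: gf4)"
definition minus_gf4 :: "gf4 \<Rightarrow> gf4 \<Rightarrow> gf4" where "x - y = (x :: gf4) + y"

fun times_gf4 :: "gf4 \<Rightarrow> gf4 \<Rightarrow> gf4" where
  "GF4 a b * GF4 c d = GF4 (a * c + b * d) (a * d + b * c + b * d)"

definition inverse_gf4 :: "gf4 \<Rightarrow> gf4" where "inverse x = x * (x :: gf4)"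
definition divide_gf4 :: "gf4 \<Rightarrow> gf4 \<Rightarrow> gf4" where "x div y = x * inverse (y :: gf4)"

instance
proof
  fix x y z :: gf4
  show "x + y + z = x + (y + z)"
    by (cases x; cases y; cases z) (simp only: plus_gf4.simps add.assoc)
  show "x + y = y + x"
    by (cases x; cases y) (simp only: plus_gf4.simps add.commute)
  show "0 + x = x"
    by (cases x) (simp add: zero_gf4_def)
  show "- x + x = 0"
    by (cases x) (simp add: uminus_gf4_def zero_gf4_def)
  show "x - y = x + - y"
    by (simp add: uminus_gf4_def minus_gf4_def)
  show "x * y * z = x * (y * z)"
    by (cases x; cases y; cases z) (simp only: plus_gf4.simps times_gf4.simps gf4.inject algebra_simps)
  show "x * y = y * x"
    by (cases x; cases y) (simp only: times_gf4.simps gf4.inject algebra_simps)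
  show "1 * x = x"
    by (cases x) (simp add: one_gf4_def)
  show "(x + y) * z = x * z + y * z"
    by (cases x; cases y; cases z) (simp only: plus_gf4.simps times_gf4.simps gf4.inject algebra_simps)
  show "(0 :: gf4) \<noteq> 1"
    by (simp add: zero_gf4_def one_gf4_def)
  show "inverse (0 :: gf4) = 0"
    by (simp add: inverse_gf4_def zero_gf4_def)
  show "x div y = x * inverse y"
    by (simp add: divide_gf4_def)
  show "inverse x * x = 1" if "x \<noteq> 0"
  proof (cases x)
    case (GF4 a b)
    with that show ?thesis
      by (cases a; cases b) (simp_all add: inverse_gf4_def zero_gf4_def one_gf4_def)
  qed
qed

end

definition omega :: gf4 where "omega = GF4 0 1"

lemma omega_square: "omega ^ 2 = omega + 1"
  by (simp add: omega_def one_gf4_def power2_eq_square)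

lemma UNIV_gf4: "UNIV = {0, 1, omega, omega ^ 2}"
proof -
  have "x \<in> {0, 1, omega, omega ^ 2}" for x
  proof (cases x)
    case (GF4 a b)
    then show ?thesis
      by (cases a; cases b)
        (simp_all add: omega_def zero_gf4_def one_gf4_def power2_eq_square)
  qed
  then show ?thesis by blast
qed

section \<open>Linear rank-width\<close>

lemma vector_space_fun: "vector_space (\<lambda>(c :: 'f :: field) (r :: 'b \<Rightarrow> 'f) y. c * r y)"
  by unfold_locales (auto simp: fun_eq_iff algebra_simps)

text \<open>The row rank of the \<open>A \<times> B\<close> matrix with entries \<open>M x y\<close>; rows are functions
  vanishing outside \<open>B\<close>.\<close>

definition matrix_rank :: "('a \<Rightarrow> 'b \<Rightarrow> 'f :: field) \<Rightarrow> 'a set \<Rightarrow> 'b set \<Rightarrow> nat" where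
  "matrix_rank M A B = vector_space.dim (\<lambda>(c :: 'f) (r :: 'b \<Rightarrow> 'f) y. c * r y)
     ((\<lambda>x y. if y \<in> B then M x y else 0) ` A)"

definition adj_matrix :: "'a set set \<Rightarrow> 'a \<Rightarrow> 'a \<Rightarrow> bit" where
  "adj_matrix E x y = (if {x, y} \<in> E then 1 else 0)"

definition d_adj_matrix :: "('a \<times> 'a) set \<Rightarrow> 'a \<Rightarrow> 'a \<Rightarrow> gf4" where
  "d_adj_matrix E x y =
     (if (x, y) \<in> E \<and> (y, x) \<in> E then 1
      else if (x, y) \<in> E then omega
      else if (y, x) \<in> E then omega ^ 2
      else 0)"

text \<open>A path \<open>p\<close> in which every remaining vertex \<open>q\<close> is pendant, attached to the path
  vertex \<open>g q\<close>.\<close>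

definition caterpillar :: "'t set \<Rightarrow> 't set set \<Rightarrow> bool" where
  "caterpillar VT ET \<longleftrightarrow> finite VT \<and>
     (\<exists>p g. p \<noteq> [] \<and> distinct p \<and> set p \<subseteq> VT \<and> g \<in> (VT - set p) \<rightarrow> set p \<and>
        ET = {{p ! i, p ! Suc i} | i. Suc i < length p} \<union> {{q, g q} | q. q \<in> VT - set p})"

definition tree_degree :: "'t set set \<Rightarrow> 't \<Rightarrow> nat" where
  "tree_degree ET x = card {e \<in> ET. x \<in> e}"

text \<open>The vertex of a one-vertex tree counts as a leaf, so that one-vertex graphs have a
  decomposition.\<close>

definition leaves :: "'t set \<Rightarrow> 't set set \<Rightarrow> 't set" where
  "leaves VT ET = {x \<in> VT. tree_degree ET x \<le> 1}"

text \<open>The tree vertices are natural numbers, which is no restriction up to isomorphism.\<close>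

definition linear_rank_decompositions ::
    "'a set \<Rightarrow> (nat set \<times> nat set set \<times> ('a \<Rightarrow> nat)) set" where
  "linear_rank_decompositions V =
     {(VT, ET, f). caterpillar VT ET \<and> bij_betw f V (leaves VT ET)}"

definition subcubic_linear_rank_decompositions ::
    "'a set \<Rightarrow> (nat set \<times> nat set set \<times> ('a \<Rightarrow> nat)) set" where
  "subcubic_linear_rank_decompositions V =
     {(VT, ET, f) \<in> linear_rank_decompositions V. \<forall>x\<in>VT. tree_degree ET x \<le> 3}"

text \<open>The vertices mapped by \<open>f\<close> to the component of \<open>x\<close> after deletion of the edge
  \<open>{x, y}\<close> from the tree.\<close>

definition edge_side :: "'a set \<Rightarrow> 't set set \<Rightarrow> ('a \<Rightarrow> 't) \<Rightarrow> 't \<Rightarrow> 't \<Rightarrow> 'a set" where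
  "edge_side V ET f x y = {v \<in> V. (x, f v) \<in> {(s, t). {s, t} \<in> ET - {{x, y}}}\<^sup>*}"

text \<open>Each tree edge is counted with both orders \<open>(A\<^sub>e, B\<^sub>e)\<close> and \<open>(B\<^sub>e, A\<^sub>e)\<close> of
  its two sides; the ranks agree, as the two matrices are transposes of each other (up to the
  automorphism of \<open>GF(4)\<close> exchanging \<open>\<omega>\<close> and \<open>\<omega>\<^sup>2\<close> in the directed case).\<close>

definition rank_decomposition_width ::
    "('a \<Rightarrow> 'a \<Rightarrow> 'f :: field) \<Rightarrow> 'a set \<Rightarrow> 't set set \<Rightarrow> ('a \<Rightarrow> 't) \<Rightarrow> nat" where
  "rank_decomposition_width M V ET f =
     (SUP (x, y)\<in>{(x, y). {x, y} \<in> ET}.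
        matrix_rank M (edge_side V ET f x y) (edge_side V ET f y x))"

definition lrw :: "'a set \<Rightarrow> 'a set set \<Rightarrow> nat" where
  "lrw V E = (INF (VT, ET, f)\<in>linear_rank_decompositions V.
     rank_decomposition_width (adj_matrix E) V ET f)"

definition d_lrw :: "'a set \<Rightarrow> ('a \<times> 'a) set \<Rightarrow> nat" where
  "d_lrw V E = (INF (VT, ET, f)\<in>linear_rank_decompositions V.
     rank_decomposition_width (d_adj_matrix E) V ET f)"

text \<open>Caterpillars of arbitrary degree include stars, on which every edge has rank at most one.
  Linear rank-width is therefore usually defined with subcubic caterpillars; both conventions
  are provided.\<close>

definition subcubic_lrw :: "'a set \<Rightarrow> 'a set set \<Rightarrow> nat" where
  "subcubic_lrw V E = (INF (VT, ET, f)\<in>subcubic_linear_rank_decompositions V.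
     rank_decomposition_width (adj_matrix E) V ET f)"

definition d_subcubic_lrw :: "'a set \<Rightarrow> ('a \<times> 'a) set \<Rightarrow> nat" where
  "d_subcubic_lrw V E = (INF (VT, ET, f)\<in>subcubic_linear_rank_decompositions V.
     rank_decomposition_width (d_adj_matrix E) V ET f)"

end

theory Submission
  imports Defs
begin

text \<open>For the layout and bag parameters the two optimisation problems agree solution by solution:
  an arc in each direction forces two intervals of bags to meet, each cut edge gives exactly one
  forward arc, and in- and out-neighbourhoods coincide. Expressions for \<open>G\<close> are turned into
  expressions for its biorientation by performing every edge insertion in both directions, and back
  by forgetting the directions. For rank-width, the matrix of the biorientation is the adjacency
  matrix with its entries read in \<open>GF(4)\<close>, and extending the field from \<open>GF(2)\<close> to
  \<open>GF(4)\<close> does not change the rank.\<close>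

section \<open>Biorientations and underlying graphs\<close>

lemma ugraph_edgeE:
  assumes "ugraph V E" and "e \<in> E"
  obtains u v where "e = {u, v}" "u \<in> V" "v \<in> V" "u \<noteq> v"
  using assms unfolding ugraph_def by blast

lemma in_biorientation [simp]: "(u, v) \<in> biorientation E \<longleftrightarrow> {u, v} \<in> E"
  by (simp add: biorientation_def)

text \<open>Stated for arbitrary digraphs, because the intermediate stages of a directed expression
  need not be symmetric.\<close>

definition underlying :: "('a \<times> 'a) set \<Rightarrow> 'a set set" where
  "underlying D = {{u, v} | u v. (u, v) \<in> D}"

lemma underlying_empty [simp]: "underlying {} = {}"
  by (simp add: underlying_def)

lemma underlying_Un: "underlying (D \<union> D') = underlying D \<union> underlying D'"
  unfolding underlying_def by blast

lemma underlying_biorientation: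
  assumes "ugraph V E"
  shows "underlying (biorientation E) = E"
proof
  show "underlying (biorientation E) \<subseteq> E"
    by (auto simp: underlying_def)
  show "E \<subseteq> underlying (biorientation E)"
  proof
    fix e assume "e \<in> E"
    moreover from this obtain u v where "e = {u, v}"
      by (rule ugraph_edgeE [OF assms])
    ultimately show "e \<in> underlying (biorientation E)"
      by (auto simp: underlying_def)
  qed
qed

section \<open>Path-width, cut-width and neighbourhood-width\<close>

lemma bag_sequence_convex:
  assumes "bag_sequence V X" "i \<le> j" "j \<le> l" "l < length X" "x \<in> X ! i" "x \<in> X ! l"
  shows "x \<in> X ! j"
proof (cases "i = j \<or> j = l")
  case False
  with assms(2,3) have "i < j" "j < l" by auto
  with assms show ?thesis
    unfolding bag_sequence_def by blast
qed (use assms in auto)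

lemma path_decompositions_biorientation:
  assumes "ugraph V E"
  shows "d_path_decompositions V (biorientation E) = path_decompositions V E"
proof (rule set_eqI, rule iffI)
  fix X assume "X \<in> path_decompositions V E"
  then have X: "bag_sequence V X" and bag: "\<And>e. e \<in> E \<Longrightarrow> \<exists>i<length X. e \<subseteq> X ! i"
    by (auto simp: path_decompositions_def)
  have "\<exists>i j. i \<le> j \<and> j < length X \<and> u \<in> X ! i \<and> v \<in> X ! j" if "{u, v} \<in> E" for u v
    using bag [OF that] by auto
  with X show "X \<in> d_path_decompositions V (biorientation E)"
    by (auto simp: d_path_decompositions_def)
next
  fix X assume "X \<in> d_path_decompositions V (biorientation E)"
  then have X: "bag_sequence V X"
    and arc: "\<And>u v. {u, v} \<in> E \<Longrightarrow> \<exists>i j. i \<le> j \<and> j < length X \<and> u \<in> X ! i \<and> v \<in> X ! j"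
    by (simp_all add: d_path_decompositions_def Ball_def)
  have "\<exists>i<length X. e \<subseteq> X ! i" if eE: "e \<in> E" for e
  proof -
    obtain u v where e: "e = {u, v}"
      by (rule ugraph_edgeE [OF assms eE])
    obtain i j where ij: "i \<le> j" "j < length X" "u \<in> X ! i" "v \<in> X ! j"
      using arc [of u v] eE unfolding e by blast
    obtain i' j' where ij': "i' \<le> j'" "j' < length X" "v \<in> X ! i'" "u \<in> X ! j'"
      using arc [of v u] eE unfolding e by (auto simp: insert_commute)
    \<comment> \<open>The later of the two starting bags lies in both intervals.\<close>
    show ?thesis
    proof (cases "i \<le> i'")
      case True
      then have "u \<in> X ! i'"
        using bag_sequence_convex [OF X] ij ij' by blast
      with e ij' show ?thesis by (intro exI [of _ i']) auto
    next
      case False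
      then have "v \<in> X ! i"
        using bag_sequence_convex [OF X, of i' i j] ij ij' by auto
      with e ij show ?thesis by (intro exI [of _ i]) auto
    qed
  qed
  with X show "X \<in> path_decompositions V E"
    by (simp add: path_decompositions_def)
qed

text \<open>Each cut edge is matched with its orientation from left to right; disjointness of the
  two sides rules out its reverse arc.\<close>

lemma card_cut_biorientation:
  "card {(u, v) \<in> biorientation E. u \<in> L_set V i \<phi> \<and> v \<in> R_set V i \<phi>} =
   card {e \<in> E. \<exists>u\<in>L_set V i \<phi>. \<exists>v\<in>R_set V i \<phi>. e = {u, v}}"
proof (rule bij_betw_same_card [of "\<lambda>(u, v). {u, v}"], rule bij_betw_imageI)
  show "inj_on (\<lambda>(u, v). {u, v}) {(u, v) \<in> biorientation E. u \<in> L_set V i \<phi> \<and> v \<in> R_set V i \<phi>}"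
    by (auto simp: inj_on_def doubleton_eq_iff L_set_def R_set_def)
  show "(\<lambda>(u, v). {u, v}) ` {(u, v) \<in> biorientation E. u \<in> L_set V i \<phi> \<and> v \<in> R_set V i \<phi>} =
      {e \<in> E. \<exists>u\<in>L_set V i \<phi>. \<exists>v\<in>R_set V i \<phi>. e = {u, v}}"
    by (auto simp: image_iff)
qed

text \<open>Adjacency is symmetric, so only pairs of the form \<open>(N, N)\<close> arise, and these
  are determined by \<open>N\<close>.\<close>

lemma card_neighbourhoods_biorientation:
  "card ((\<lambda>u. ({v \<in> R. (u, v) \<in> biorientation E}, {v \<in> R. (v, u) \<in> biorientation E})) ` L) =
   card ((\<lambda>u. {v. {u, v} \<in> E} \<inter> R) ` L)"
proof -
  have "(\<lambda>u. ({v \<in> R. (u, v) \<in> biorientation E}, {v \<in> R. (v, u) \<in> biorientation E})) ` L =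
      (\<lambda>N. (N, N)) ` (\<lambda>u. {v. {u, v} \<in> E} \<inter> R) ` L"
    unfolding image_image by (rule image_cong) (auto simp: insert_commute)
  then show ?thesis
    by (simp add: card_image inj_on_def)
qed

section \<open>Linear NLC-width and linear clique-width\<close>

lemma lnlc_biorientation:
  "lnlc k V E lab \<Longrightarrow> d_lnlc k V (biorientation E) lab"
proof (induction rule: lnlc.induct)
  case (lnlc_vertex a v)
  then have "d_lnlc k {v} {} (\<lambda>_. a)" by (rule d_lnlc_vertex)
  then show ?case by (simp add: biorientation_def)
next
  case (lnlc_insert V E lab v a S)
  have "biorientation (E \<union> {{u, v} | u. u \<in> V \<and> (lab u, a) \<in> S}) =
      biorientation E \<union> {(u, v) | u. u \<in> V \<and> (lab u, a) \<in> S}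
        \<union> {(v, u) | u. u \<in> V \<and> (lab u, a) \<in> S}"
    by (auto simp: doubleton_eq_iff)
  \<comment> \<open>The same relation \<open>S\<close> serves both directions.\<close>
  then show ?case
    using d_lnlc_insert [OF lnlc_insert.IH lnlc_insert.hyps(2-4) lnlc_insert.hyps(4)] by (simp only:)
next
  case (lnlc_relabel V E lab f)
  show ?case by (rule d_lnlc_relabel) (use lnlc_relabel in simp_all)
qed

lemma d_lnlc_underlying:
  "d_lnlc k V D lab \<Longrightarrow> lnlc k V (underlying D) lab"
proof (induction rule: d_lnlc.induct)
  case (d_lnlc_vertex a v)
  then show ?case by (simp add: lnlc_vertex)
next
  case (d_lnlc_insert V D lab v a S S')
  \<comment> \<open>An arc in either direction leaves the same edge at \<open>v\<close>, so the
    union of the two relations describes all new edges.\<close>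
  have "underlying (D \<union> {(u, v) | u. u \<in> V \<and> (lab u, a) \<in> S}
        \<union> {(v, u) | u. u \<in> V \<and> (lab u, a) \<in> S'}) =
      underlying D \<union> {{u, v} | u. u \<in> V \<and> (lab u, a) \<in> S \<union> S'}"
    unfolding underlying_Un by (auto simp: underlying_def insert_commute)
  moreover have "S \<union> S' \<subseteq> {1..k} \<times> {1..k}"
    using d_lnlc_insert.hyps by blast
  ultimately show ?case
    using lnlc_insert [OF d_lnlc_insert.IH d_lnlc_insert.hyps(2,3)] by presburger
next
  case (d_lnlc_relabel V D lab f)
  show ?case by (rule lnlc_relabel) (use d_lnlc_relabel in simp_all)
qed

text \<open>An undirected join becomes two opposite directed joins in succession; no label changes
  in between, so \<open>k\<close> is preserved.\<close>

lemma lc_biorientation: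
  "lc k V E lab \<Longrightarrow> d_lc k V (biorientation E) lab"
proof (induction rule: lc.induct)
  case (lc_vertex a v)
  then have "d_lc k {v} {} (\<lambda>_. a)" by (rule d_lc_vertex)
  then show ?case by (simp add: biorientation_def)
next
  case (lc_insert V E lab v a)
  show ?case by (rule d_lc_insert) (use lc_insert in simp_all)
next
  case (lc_join V E lab a b)
  have "biorientation (E \<union> {{u, v} | u v. u \<in> V \<and> v \<in> V \<and> lab u = a \<and> lab v = b}) =
      biorientation E \<union> {(u, v) | u v. u \<in> V \<and> v \<in> V \<and> lab u = a \<and> lab v = b}
        \<union> {(u, v) | u v. u \<in> V \<and> v \<in> V \<and> lab u = b \<and> lab v = a}"
    by (auto simp: doubleton_eq_iff) blast+
  then show ?case
    using d_lc_join [OF d_lc_join [OF lc_join.IH lc_join.hyps(2-4)]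
        lc_join.hyps(3,2) lc_join.hyps(4) [symmetric]] by simp
next
  case (lc_relabel V E lab a b)
  show ?case by (rule d_lc_relabel) (use lc_relabel in simp_all)
qed

lemma d_lc_underlying:
  "d_lc k V D lab \<Longrightarrow> lc k V (underlying D) lab"
proof (induction rule: d_lc.induct)
  case (d_lc_vertex a v)
  then show ?case by (simp add: lc_vertex)
next
  case (d_lc_insert V D lab v a)
  show ?case by (rule lc_insert) (use d_lc_insert in simp_all)
next
  case (d_lc_join V D lab a b)
  have "underlying (D \<union> {(u, v) | u v. u \<in> V \<and> v \<in> V \<and> lab u = a \<and> lab v = b}) =
      underlying D \<union> {{u, v} | u v. u \<in> V \<and> v \<in> V \<and> lab u = a \<and> lab v = b}"
    unfolding underlying_Un by (auto simp: underlying_def)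
  then show ?case
    using lc_join [OF d_lc_join.IH d_lc_join.hyps(2-4)] by simp
next
  case (d_lc_relabel V D lab a b)
  show ?case by (rule lc_relabel) (use d_lc_relabel in simp_all)
qed

section \<open>Linear rank-width\<close>

text \<open>Coordinates with respect to the basis \<open>1\<close>, \<open>omega\<close> over
  \<open>GF(2)\<close>.\<close>

fun gf4_fst :: "gf4 \<Rightarrow> bit" where "gf4_fst (GF4 a b) = a"
fun gf4_snd :: "gf4 \<Rightarrow> bit" where "gf4_snd (GF4 a b) = b"

definition gf4_of_bit :: "bit \<Rightarrow> gf4" where "gf4_of_bit a = GF4 a 0"

lemma gf4_of_bit_simps [simp]:
  "gf4_of_bit 0 = 0" "gf4_of_bit 1 = 1"
  "gf4_of_bit (a + b) = gf4_of_bit a + gf4_of_bit b"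
  "gf4_of_bit (a * b) = gf4_of_bit a * gf4_of_bit b"
  by (simp_all add: gf4_of_bit_def zero_gf4_def one_gf4_def)

lemma gf4_coordinates_of_bit [simp]:
  "gf4_fst (gf4_of_bit a) = a" "gf4_snd (gf4_of_bit a) = 0"
  by (simp_all add: gf4_of_bit_def)

lemma gf4_coordinates_simps [simp]:
  "gf4_fst 0 = 0" "gf4_snd 0 = 0"
  "gf4_fst (x + y) = gf4_fst x + gf4_fst y"
  "gf4_snd (x + y) = gf4_snd x + gf4_snd y"
  by (simp_all add: zero_gf4_def) (cases x; cases y; simp)+

text \<open>For fixed \<open>x\<close>, both coordinates of the product are
  \<open>GF(2)\<close>-linear in those of \<open>y\<close>; this is how scaling by \<open>x\<close>
  acts on coordinates.\<close>

lemma gf4_coordinates_times: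
  "gf4_fst (x * y) = gf4_fst x * gf4_fst y + gf4_snd x * gf4_snd y"
  "gf4_snd (x * y) = gf4_fst x * gf4_snd y + gf4_snd x * (gf4_fst y + gf4_snd y)"
  by (cases x; cases y; simp only: times_gf4.simps gf4_fst.simps gf4_snd.simps algebra_simps)+

\<comment> \<open>These rules would rewrite the scalar multiplication inside \<open>F2.span\<close> below.\<close>
declare add_bit_eq_xor [simp del] mult_bit_eq_and [simp del]

text \<open>A \<open>GF(2)\<close>-basis of \<open>S\<close> is carried to a
  \<open>GF(4)\<close>-basis of the span of the embedded set, and the embedding is
  injective.\<close>

lemma dim_gf4_of_bit:
  fixes S :: "('b \<Rightarrow> bit) set"
  shows "vector_space.dim (\<lambda>(c :: gf4) (r :: 'b \<Rightarrow> gf4) y. c * r y) ((\<lambda>r y. gf4_of_bit (r y)) ` S) =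
    vector_space.dim (\<lambda>(c :: bit) (r :: 'b \<Rightarrow> bit) y. c * r y) S"
proof -
  interpret F2: vector_space "\<lambda>(c :: bit) (r :: 'b \<Rightarrow> bit) y. c * r y"
    by (rule vector_space_fun)
  interpret F4: vector_space "\<lambda>(c :: gf4) (r :: 'b \<Rightarrow> gf4) y. c * r y"
    by (rule vector_space_fun)
  define emb :: "('b \<Rightarrow> bit) \<Rightarrow> 'b \<Rightarrow> gf4" where "emb = (\<lambda>r y. gf4_of_bit (r y))"
  have inj: "inj emb"
    by (rule inj_on_inverseI [of _ "\<lambda>r y. gf4_fst (r y)"]) (simp add: emb_def)
  have emb_span: "emb r \<in> F4.span (emb ` T)" if "r \<in> F2.span T" for r T
    using that
  proof (rule F2.span_induct)
    show "F2.subspace {r. emb r \<in> F4.span (emb ` T)}"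
    proof (rule F2.subspaceI)
      have "emb 0 = 0" by (auto simp: emb_def)
      then show "0 \<in> {r. emb r \<in> F4.span (emb ` T)}"
        by (simp add: F4.span_zero)
      fix r s assume r: "r \<in> {r. emb r \<in> F4.span (emb ` T)}"
      have "emb (\<lambda>y. c * r y) = (\<lambda>y. gf4_of_bit c * emb r y)" for c
        by (auto simp: emb_def)
      with r show "(\<lambda>y. c * r y) \<in> {r. emb r \<in> F4.span (emb ` T)}" for c
        by (simp add: F4.span_scale)
      assume s: "s \<in> {r. emb r \<in> F4.span (emb ` T)}"
      have "emb (r + s) = emb r + emb s"
        by (simp add: emb_def fun_eq_iff)
      with r s show "r + s \<in> {r. emb r \<in> F4.span (emb ` T)}"
        by (simp add: F4.span_add)
    qed
  qed (simp add: F4.span_base)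
  \<comment> \<open>Both coordinate maps send the \<open>GF(4)\<close>-span of a set of 0/1-vectors into its
    \<open>GF(2)\<close>-span; this is what makes independence survive the field extension.\<close>
  have coordinates_span: "(\<lambda>y. gf4_fst (r y)) \<in> F2.span T \<and> (\<lambda>y. gf4_snd (r y)) \<in> F2.span T"
    if "r \<in> F4.span (emb ` T)" for r T
    using that
  proof (rule F4.span_induct)
    \<comment> \<open>Both coordinates are tracked together because multiplication by
      \<open>omega\<close> mixes them.\<close>
    let ?U = "{r. (\<lambda>y. gf4_fst (r y)) \<in> F2.span T \<and> (\<lambda>y. gf4_snd (r y)) \<in> F2.span T}"
    have add: "(\<lambda>y. r y + s y) \<in> F2.span T" if "r \<in> F2.span T" "s \<in> F2.span T" for r s
      using F2.span_add [OF that] by (simp add: plus_fun_def)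
    have zero: "(\<lambda>y. 0) \<in> F2.span T"
      using F2.span_zero by (simp add: zero_fun_def)
    show "F4.subspace ?U"
    proof (rule F4.subspaceI)
      show "0 \<in> ?U" by (simp add: zero)
      fix r s c assume r: "r \<in> ?U"
      then show "(\<lambda>y. c * r y) \<in> ?U"
        by (simp add: gf4_coordinates_times add F2.span_scale)
      assume "s \<in> ?U"
      with r show "r + s \<in> ?U" by (simp add: add)
    qed
    fix x assume "x \<in> emb ` T"
    \<comment> \<open>The first coordinates of an embedded vector give back an element of
      \<open>T\<close>, the second ones vanish.\<close>
    then show "(\<lambda>y. gf4_fst (x y)) \<in> F2.span T \<and> (\<lambda>y. gf4_snd (x y)) \<in> F2.span T"
      by (auto simp: emb_def zero F2.span_base)
  qed
  obtain B where B: "B \<subseteq> S" "F2.independent B" "S \<subseteq> F2.span B" "card B = F2.dim S"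
    by (rule F2.basis_exists)
  have "F4.independent (emb ` B)"
  proof
    assume "F4.dependent (emb ` B)"
    then obtain b where b: "b \<in> B" "emb b \<in> F4.span (emb ` B - {emb b})"
      by (auto simp: F4.dependent_def)
    have "emb ` B - {emb b} = emb ` (B - {b})"
      using inj by (auto simp: inj_def)
    \<comment> \<open>First coordinates undo \<open>emb\<close>, so a dependence over
      \<open>GF(4)\<close> descends to \<open>GF(2)\<close>.\<close>
    with b(2) have "(\<lambda>y. gf4_fst (emb b y)) \<in> F2.span (B - {b})"
      using coordinates_span by simp
    then have "b \<in> F2.span (B - {b})" by (simp add: emb_def)
    with b(1) B(2) show False by (auto simp: F2.dependent_def)
  qed
  moreover have "F4.span (emb ` B) = F4.span (emb ` S)"
  proof (rule F4.span_eq [THEN iffD2], rule conjI)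
    show "emb ` B \<subseteq> F4.span (emb ` S)"
      using B(1) by (auto intro: F4.span_base)
    show "emb ` S \<subseteq> F4.span (emb ` B)"
      using B(3) emb_span by blast
  qed
  ultimately have "F4.dim (emb ` S) = card (emb ` B)"
    by (intro F4.dim_eq_card)
  also have "\<dots> = F2.dim S"
    using B(4) inj by (simp add: card_image inj_on_subset)
  finally show ?thesis by (simp add: emb_def)
qed

text \<open>The embedding fixes zero, so it commutes with padding the rows by zeros outside
  \<open>B\<close>.\<close>

lemma matrix_rank_gf4_of_bit:
  "matrix_rank (\<lambda>x y. gf4_of_bit (M x y)) A B = matrix_rank M A B"
proof -
  have "(\<lambda>x y. if y \<in> B then gf4_of_bit (M x y) else 0) ` A =
      (\<lambda>r y. gf4_of_bit (r y)) ` (\<lambda>x y. if y \<in> B then M x y else 0) ` A"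
    unfolding image_image by (rule image_cong) auto
  then show ?thesis
    by (simp add: matrix_rank_def dim_gf4_of_bit)
qed

text \<open>Arcs come in opposite pairs, so the entries \<open>omega\<close> and
  \<open>omega ^ 2\<close> never occur.\<close>

lemma d_adj_matrix_biorientation:
  "d_adj_matrix (biorientation E) = (\<lambda>x y. gf4_of_bit (adj_matrix E x y))"
  by (auto simp: fun_eq_iff d_adj_matrix_def adj_matrix_def insert_commute)

lemma rank_decomposition_width_biorientation:
  "rank_decomposition_width (d_adj_matrix (biorientation E)) V ET f =
   rank_decomposition_width (adj_matrix E) V ET f"
  by (simp add: rank_decomposition_width_def d_adj_matrix_biorientation matrix_rank_gf4_of_bit)

theorem theorem4p4:
  fixes V :: "'a set" and E :: "'a set set"
  assumes "ugraph V E"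
  shows "pw V E = d_pw V (biorientation E)
    \<and> cutw V E = d_cutw V (biorientation E)
    \<and> nw V E = d_nw V (biorientation E)
    \<and> lnlcw V E = d_lnlcw V (biorientation E)
    \<and> lcw V E = d_lcw V (biorientation E)
    \<and> lrw V E = d_lrw V (biorientation E)
    \<and> subcubic_lrw V E = d_subcubic_lrw V (biorientation E)"
proof (intro conjI)
  show "pw V E = d_pw V (biorientation E)"
    by (simp add: pw_def d_pw_def path_decompositions_biorientation [OF assms])
  show "cutw V E = d_cutw V (biorientation E)"
    unfolding cutw_def d_cutw_def card_cut_biorientation ..
  show "nw V E = d_nw V (biorientation E)"
    unfolding nw_def d_nw_def card_neighbourhoods_biorientation ..
  \<comment> \<open>The predicates under \<open>LEAST\<close> become identical, so the values agree
    even for empty \<open>V\<close>, which no expression builds.\<close>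
  have "lnlc k V E lab \<longleftrightarrow> d_lnlc k V (biorientation E) lab" for k lab
    using lnlc_biorientation d_lnlc_underlying underlying_biorientation [OF assms] by metis
  then show "lnlcw V E = d_lnlcw V (biorientation E)"
    by (simp add: lnlcw_def d_lnlcw_def)
  have "lc k V E lab \<longleftrightarrow> d_lc k V (biorientation E) lab" for k lab
    using lc_biorientation d_lc_underlying underlying_biorientation [OF assms] by metis
  then show "lcw V E = d_lcw V (biorientation E)"
    by (simp add: lcw_def d_lcw_def)
  show "lrw V E = d_lrw V (biorientation E)"
    by (simp add: lrw_def d_lrw_def rank_decomposition_width_biorientation)
  show "subcubic_lrw V E = d_subcubic_lrw V (biorientation E)"
    by (simp add: subcubic_lrw_def d_subcubic_lrw_def rank_decomposition_width_biorientation)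
qed

end
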